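(* For each of the following 18 triples $(\sigma,\tau_0,\tau_1)$, the indicated function $h(x,y)$ on $\triangle$ is an eigenfunction with eigenvalue $1$ of the transfer operator $\mathcal{L}_{T_{\sigma,\tau_0,\tau_1}}$, i.e. $\mathcal{L}_{T_{\sigma,\tau_0,\tau_1}}h=h$ on $\triangle$: \begin{itemize} \item $h=\frac{1}{x(y+1)}$ for $(e,e,e)$; \item $h=\frac{1}{x(1-y)}$ for $(e,23,e)$, $(e,132,e)$, $(13,23,13)$, $(13,132,13)$; \item $h=\frac{1}{(y+1)(1-x+y)}$ for $(12,12,12)$; \item $h=\frac{1}{(1-y)(1-x+y)}$ for $(12,13,12)$, $(12,123,12)$, $(123,13,132)$, $(123,123,132)$; \item $h=\frac{1}{(x-2)(1-y)}$ for $(13,13,13)$; \item $h=\frac{1}{x(1-x+y)}$ for $(23,e,23)$, $(23,12,23)$, $(132,e,123)$, $(132,12,123)$; \item $h=\frac{1}{x(x-y+1)}$ for $(23,23,23)$; \item $h=\frac{1}{(1-y)(x-y+1)}$ for $(123,132,132)$; \item $h=\frac{1}{(x-2)(1-x+y)}$ for $(132,123,123)$. \end{itemize}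
   Context: Let $\triangle=\{(x,y)\in\mathbb{R}^2: 0<y<x<1\}$. Triangle partition maps. The elements of $S_3$ are written $e,12,13,23,123,132$ and identified with the $3\times 3$ permutation matrices acting on column vectors $v=(v_1,v_2,v_3)^T$ by: $e\,v=v$, $(12)v=(v_2,v_1,v_3)^T$, $(13)v=(v_3,v_2,v_1)^T$, $(23)v=(v_1,v_3,v_2)^T$, $(123)v=(v_2,v_3,v_1)^T$, $(132)v=(v_3,v_1,v_2)^T$. Put $$B=\begin{pmatrix}1&1&1\\0&1&1\\0&0&1\end{pmatrix},\quad A_0=\begin{pmatrix}0&0&1\\1&0&0\\0&1&1\end{pmatrix},\quad A_1=\begin{pmatrix}1&0&1\\0&1&0\\0&0&1\end{pmatrix}.$$ For $(\sigma,\tau_0,\tau_1)\in S_3^3$ let $F_0=\sigma A_0\tau_0$, $F_1=\sigma A_1\tau_1$ (matrix products). For $k\ge 0$ and $(x,y)\in\triangle$ write $(d_k,p_k,q_k)^T=BF_1^kF_0B^{-1}(1,x,y)^T$ and $S_k(x,y)=(p_k/d_k,\,q_k/d_k)$; here $d_k>0$. $S_k$ maps $\triangle$ bijectively onto an open subtriangle $\triangle_k\subset\triangle$, the $\triangle_k$ are pairwise disjoint, and the triangle partition map $T_{\sigma,\tau_0,\tau_1}$ is defined on $\bigcup_k\triangle_k$ by $T_{\sigma,\tau_0,\tau_1}=S_k^{-1}$ on $\triangle_k$. Its transfer operator is $$\mathcal{L}_{T_{\sigma,\tau_0,\tau_1}}f(x,y)=\sum_{(a,b):T_{\sigma,\tau_0,\tau_1}(a,b)=(x,y)}\frac{f(a,b)}{|\mathrm{Jac}(T_{\sigma,\tau_0,\tau_1})(a,b)|}=\sum_{k=0}^\infty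 \frac{1}{d_k(x,y)^3}\,f(S_k(x,y)).$$ For example, $\mathcal{L}_{T_{e,e,e}}f(x,y)=\sum_{k\ge0}\frac{1}{(kx+y+1)^3}f\left(\frac{1}{kx+y+1},\frac{x}{kx+y+1}\right)$. *)

theory Defs
  imports "HOL-Analysis.Analysis"
begin

definition triangle :: "(real^2) set" where
  "triangle = {p. 0 < p $ 2 \<and> p $ 2 < p $ 1 \<and> p $ 1 < 1}"

datatype s3 = P_e | P_12 | P_13 | P_23 | P_123 | P_132

text \<open>The matrices are fixed by their action on column vectors, given in \<open>perm_mat_action\<close> below;
  this is what determines the convention for the two 3-cycles.\<close>

fun perm_mat :: "s3 \<Rightarrow> real^3^3" where
  "perm_mat P_e = vector [vector [1,0,0], vector [0,1,0], vector [0,0,1]]"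
| "perm_mat P_12 = vector [vector [0,1,0], vector [1,0,0], vector [0,0,1]]"
| "perm_mat P_13 = vector [vector [0,0,1], vector [0,1,0], vector [1,0,0]]"
| "perm_mat P_23 = vector [vector [1,0,0], vector [0,0,1], vector [0,1,0]]"
| "perm_mat P_123 = vector [vector [0,1,0], vector [0,0,1], vector [1,0,0]]"
| "perm_mat P_132 = vector [vector [0,0,1], vector [1,0,0], vector [0,1,0]]"

lemma perm_mat_action:
  "perm_mat P_e *v v = v"
  "perm_mat P_12 *v v = vector [v $ 2, v $ 1, v $ 3]"
  "perm_mat P_13 *v v = vector [v $ 3, v $ 2, v $ 1]"
  "perm_mat P_23 *v v = vector [v $ 1, v $ 3, v $ 2]"
  "perm_mat P_123 *v v = vector [v $ 2, v $ 3, v $ 1]"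
  "perm_mat P_132 *v v = vector [v $ 3, v $ 1, v $ 2]"
  by (simp_all add: vec_eq_iff forall_3 matrix_vector_mult_def sum_3)

definition mat_B :: "real^3^3" where
  "mat_B = vector [vector [1,1,1], vector [0,1,1], vector [0,0,1]]"

definition mat_A0 :: "real^3^3" where
  "mat_A0 = vector [vector [0,0,1], vector [1,0,0], vector [0,1,1]]"

definition mat_A1 :: "real^3^3" where
  "mat_A1 = vector [vector [1,0,1], vector [0,1,0], vector [0,0,1]]"

definition mat_F0 :: "s3 \<Rightarrow> s3 \<Rightarrow> real^3^3" where
  "mat_F0 \<sigma> \<tau>0 = perm_mat \<sigma> ** mat_A0 ** perm_mat \<tau>0"

definition mat_F1 :: "s3 \<Rightarrow> s3 \<Rightarrow> real^3^3" where
  "mat_F1 \<sigma> \<tau>1 = perm_mat \<sigma> ** mat_A1 ** perm_mat \<tau>1"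

primrec mat_pow :: "real^'n^'n \<Rightarrow> nat \<Rightarrow> real^'n^'n" where
  "mat_pow M 0 = mat 1"
| "mat_pow M (Suc k) = M ** mat_pow M k"

text \<open>The homogeneous coordinates $(d_k, p_k, q_k)$ of the $k$-th inverse branch at $(x,y)$.\<close>

definition branch_vec :: "s3 \<Rightarrow> s3 \<Rightarrow> s3 \<Rightarrow> nat \<Rightarrow> real^2 \<Rightarrow> real^3" where
  "branch_vec \<sigma> \<tau>0 \<tau>1 k p =
     (mat_B ** mat_pow (mat_F1 \<sigma> \<tau>1) k ** mat_F0 \<sigma> \<tau>0 ** matrix_inv mat_B)
       *v vector [1, p $ 1, p $ 2]"

definition inv_branch :: "s3 \<Rightarrow> s3 \<Rightarrow> s3 \<Rightarrow> nat \<Rightarrow> real^2 \<Rightarrow> real^2" where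
  "inv_branch \<sigma> \<tau>0 \<tau>1 k p =
     (let v = branch_vec \<sigma> \<tau>0 \<tau>1 k p in vector [v $ 2 / v $ 1, v $ 3 / v $ 1])"

definition subtriangle :: "s3 \<Rightarrow> s3 \<Rightarrow> s3 \<Rightarrow> nat \<Rightarrow> (real^2) set" where
  "subtriangle \<sigma> \<tau>0 \<tau>1 k = inv_branch \<sigma> \<tau>0 \<tau>1 k ` triangle"

definition tp_domain :: "s3 \<Rightarrow> s3 \<Rightarrow> s3 \<Rightarrow> (real^2) set" where
  "tp_domain \<sigma> \<tau>0 \<tau>1 = (\<Union>k. subtriangle \<sigma> \<tau>0 \<tau>1 k)"

text \<open>The triangle partition map; its values are only meaningful on \<open>tp_domain\<close>, where the index
  \<open>k\<close> is unique because the subtriangles are pairwise disjoint.\<close>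

definition tp_map :: "s3 \<Rightarrow> s3 \<Rightarrow> s3 \<Rightarrow> real^2 \<Rightarrow> real^2" where
  "tp_map \<sigma> \<tau>0 \<tau>1 p =
     (let k = (THE k. p \<in> subtriangle \<sigma> \<tau>0 \<tau>1 k)
      in the_inv_into triangle (inv_branch \<sigma> \<tau>0 \<tau>1 k) p)"

definition tp_fibre :: "s3 \<Rightarrow> s3 \<Rightarrow> s3 \<Rightarrow> real^2 \<Rightarrow> (real^2) set" where
  "tp_fibre \<sigma> \<tau>0 \<tau>1 p = {q \<in> tp_domain \<sigma> \<tau>0 \<tau>1. tp_map \<sigma> \<tau>0 \<tau>1 q = p}"

definition transfer_term ::
    "s3 \<Rightarrow> s3 \<Rightarrow> s3 \<Rightarrow> (real^2 \<Rightarrow> real) \<Rightarrow> real^2 \<Rightarrow> real" where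
  "transfer_term \<sigma> \<tau>0 \<tau>1 f q = f q / \<bar>det (jacobian (tp_map \<sigma> \<tau>0 \<tau>1) (at q))\<bar>"

definition transfer_op ::
    "s3 \<Rightarrow> s3 \<Rightarrow> s3 \<Rightarrow> (real^2 \<Rightarrow> real) \<Rightarrow> real^2 \<Rightarrow> real" where
  "transfer_op \<sigma> \<tau>0 \<tau>1 f p = infsum (transfer_term \<sigma> \<tau>0 \<tau>1 f) (tp_fibre \<sigma> \<tau>0 \<tau>1 p)"

text \<open>Since \<open>infsum\<close> is \<open>0\<close> for divergent sums, convergence is required explicitly.\<close>

definition is_eigenfunction ::
    "s3 \<Rightarrow> s3 \<Rightarrow> s3 \<Rightarrow> real \<Rightarrow> (real^2 \<Rightarrow> real) \<Rightarrow> bool" where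
  "is_eigenfunction \<sigma> \<tau>0 \<tau>1 c h \<longleftrightarrow>
     (\<exists>p\<in>triangle. h p \<noteq> 0) \<and>
     (\<forall>p\<in>triangle.
        transfer_term \<sigma> \<tau>0 \<tau>1 h summable_on tp_fibre \<sigma> \<tau>0 \<tau>1 p \<and>
        transfer_op \<sigma> \<tau>0 \<tau>1 h p = c * h p)"

end

theory Submission
  imports Defs
begin

text \<open>The points of the triangle have positive barycentric coordinates
$u = (1-x,\, x-y,\, y) = B^{-1}(1,x,y)^T$ of sum $1$. In all the triples considered,
$\tau_1 = \sigma^{-1}$, so $F_1^k F_0 = \sigma A_1^k A_0 \tau_0$: up to the permutations $\sigma$
and $\tau_0$ of the coordinates, every inverse branch is the one of the triple $(e,e,e)$, namely,
with $w = \tau_0 u$,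
\[ w \mapsto (w_3 + k(w_2+w_3),\; w_1,\; w_2+w_3)/d_k, \qquad d_k = 1 + w_3 + k(w_2+w_3). \]
The denominators form an arithmetic progression with difference $b = w_2+w_3$, which is the reason
why the series of the transfer operator can telescope through
\[ \frac{1}{(a+kb)(a+(k+1)b)} = \frac1b\Bigl(\frac1{a+kb} - \frac1{a+(k+1)b}\Bigr),
   \qquad \sum_{k\ge0} \frac{1}{(a+kb)(a+(k+1)b)} = \frac{1}{ab}. \]

Two kinds of functions produce such a series. In \<open>eigenfunction_forward\<close>, $h$ has the form
$c/((v_2+v_3)(1+v_3))$ in the permuted coordinates, and its $k$-th term is $c/(d_k d_{k+1})$. In
\<open>eigenfunction_backward\<close>, $h$ has the form $1/((v_2+v_3)(v_1+v_2))$, and the $k$-th term is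
$1/(d_{k-1} d_k)$ with $d_{-1} = d_0 - b$. The value of the series is a function of $w = \tau_0 u$, whereas the
terms were computed from the expression of $h$ in $v = \sigma^{-1} u$; hence $h$ is an
eigenfunction when, rewritten in the coordinates $w$, it is equal to the sum of the series.
All 18 functions are instances of these two patterns.

What remains is to identify the transfer operator, which is defined by the fibres and the
Jacobian of the map, with the series over the branches. The branches are projective maps of
matrices of determinant $\pm1$, so each is inverted by a projective map, and its Jacobian
is $\pm d_k^{-3}$ (\<open>proj_map_has_derivative\<close>). The index $k$ is the
integer part of $v_1/v_3$ at the image point (\<open>branch_index_unique\<close>), so the images of
different branches are disjoint.\<close>

declare perm_mat.simps [simp del]

section \<open>Projective maps of the plane\<close>

definition homog :: "real^2 \<Rightarrow> real^3" where
  "homog p = vector [1, p $ 1, p $ 2]"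

definition proj_map :: "real^3^3 \<Rightarrow> real^2 \<Rightarrow> real^2" where
  "proj_map M p = vector [(M *v homog p) $ 2 / (M *v homog p) $ 1,
                          (M *v homog p) $ 3 / (M *v homog p) $ 1]"

lemma matrix_inv_left:
  fixes M :: "real^'n^'n"
  shows "invertible M \<Longrightarrow> matrix_inv M ** M = mat 1"
  unfolding invertible_def matrix_inv_def by (rule someI2_ex) auto

lemma matrix_inv_right:
  fixes M :: "real^'n^'n"
  shows "invertible M \<Longrightarrow> M ** matrix_inv M = mat 1"
  unfolding invertible_def matrix_inv_def by (rule someI2_ex) auto

lemma homog_proj_map:
  assumes "(M *v homog p) $ 1 \<noteq> 0"
  shows "homog (proj_map M p) = (1 / (M *v homog p) $ 1) *s (M *v homog p)"
  using assms by (simp add: homog_def proj_map_def vec_eq_iff forall_3)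

text \<open>At the image of \<open>p\<close>, the denominator of the inverse projective map is the reciprocal of the
  denominator at \<open>p\<close>; this is what turns the Jacobian of the inverse into $d_k^3$ later on.\<close>

lemma mult_homog_proj_map_inverse:
  assumes "invertible M" "(M *v homog p) $ 1 \<noteq> 0"
  shows "matrix_inv M *v homog (proj_map M p) = (1 / (M *v homog p) $ 1) *s homog p"
  using assms by (simp add: homog_proj_map vector_scalar_commute matrix_vector_mul_assoc
      matrix_inv_left)

lemma proj_map_matrix_inv:
  assumes "invertible M" "(M *v homog p) $ 1 \<noteq> 0"
  shows "proj_map (matrix_inv M) (proj_map M p) = p"
  using assms
  by (subst proj_map_def)
    (simp add: mult_homog_proj_map_inverse, simp add: homog_def vec_eq_iff forall_2)

text \<open>By the quotient rule the $2\times2$ determinant has denominator $L_1^4$, where $L_i$ are the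
  coordinates of \<open>M *v homog q\<close>. Replacing the first column of \<open>M\<close> by
  $L$ preserves $\det M$, and eliminating with the pivot $L_1$ then shows that the numerator is
  $L_1 \det M$, which cancels one power.\<close>

lemma proj_map_has_derivative:
  assumes "(M *v homog q) $ 1 \<noteq> 0"
  obtains D where "(proj_map M has_derivative D) (at q)"
    and "det (matrix D) = det M / ((M *v homog q) $ 1) ^ 3"
proof -
  define L :: "3 \<Rightarrow> real^2 \<Rightarrow> real" where "L = (\<lambda>i p. M$i$1 + M$i$2 * p$1 + M$i$3 * p$2)"
  define D where "D = (\<lambda>h::real^2.
      (((M$2$2 * h$1 + M$2$3 * h$2) * L 1 q - L 2 q * (M$1$2 * h$1 + M$1$3 * h$2)) / (L 1 q)\<^sup>2) *\<^sub>R axis 1 1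
    + (((M$3$2 * h$1 + M$3$3 * h$2) * L 1 q - L 3 q * (M$1$2 * h$1 + M$1$3 * h$2)) / (L 1 q)\<^sup>2) *\<^sub>R axis 2 1
      :: real^2)"
  have L: "(M *v homog p) $ i = L i p" for i p
    by (simp add: L_def homog_def matrix_vector_mult_def sum_3)
  have L1: "L 1 q \<noteq> 0"
    using assms by (simp add: L)
  have *: "proj_map M = (\<lambda>p. (L 2 p / L 1 p) *\<^sub>R axis 1 1 + (L 3 p / L 1 p) *\<^sub>R axis 2 1)"
    by (simp add: fun_eq_iff proj_map_def L vec_eq_iff forall_2 axis_def)
  have "(L i has_derivative (\<lambda>h. M$i$2 * h$1 + M$i$3 * h$2)) (at q)" for i
    unfolding L_def by (auto intro!: derivative_eq_intros bounded_linear.has_derivative[OF bounded_linear_vec_nth])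
  note [derivative_intros] = this
  have "(proj_map M has_derivative D) (at q)"
    unfolding * D_def
    by (rule derivative_eq_intros refl L1)+
       (use L1 in \<open>simp add: fun_eq_iff field_simps power2_eq_square\<close>)
  moreover have "det (matrix D) = det M / ((M *v homog q) $ 1) ^ 3"
  proof -
    have "det (matrix D) =
       ((M$2$2 * L 1 q - L 2 q * M$1$2) * (M$3$3 * L 1 q - L 3 q * M$1$3)
      - (M$2$3 * L 1 q - L 2 q * M$1$3) * (M$3$2 * L 1 q - L 3 q * M$1$2)) / (L 1 q)^4"
      using L1 by (simp add: det_2 matrix_def D_def axis_def)
        (simp add: field_simps power_numeral_reduce)
    also have "(M$2$2 * L 1 q - L 2 q * M$1$2) * (M$3$3 * L 1 q - L 3 q * M$1$3)
      - (M$2$3 * L 1 q - L 2 q * M$1$3) * (M$3$2 * L 1 q - L 3 q * M$1$2) = L 1 q * det M"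
      unfolding det_3 L_def by algebra
    also have "L 1 q * det M / (L 1 q)^4 = det M / (L 1 q)^3"
      using L1 by (simp add: power_numeral_reduce)
    finally show ?thesis by (simp add: L)
  qed
  ultimately show thesis by (rule that)
qed

section \<open>Barycentric coordinates and the inverse branches\<close>

definition bary :: "real^2 \<Rightarrow> real^3" where
  "bary p = vector [1 - p $ 1, p $ 1 - p $ 2, p $ 2]"

text \<open>The inverse branch $A_1^k A_0$ of the triple $(e,e,e)$ in homogeneous barycentric coordinates.\<close>

definition base_branch :: "nat \<Rightarrow> real^3 \<Rightarrow> real^3" where
  "base_branch k w = vector [w $ 3 + k * (w $ 2 + w $ 3), w $ 1, w $ 2 + w $ 3]"

lemma triangle_iff_bary_pos: "p \<in> triangle \<longleftrightarrow> (\<forall>i. bary p $ i > 0)"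
  by (auto simp: triangle_def bary_def forall_3)

lemma open_triangle: "open triangle"
proof -
  have "open {p::real^2. 0 < p $ 2 \<and> p $ 2 < p $ 1 \<and> p $ 1 < 1}"
    by (intro open_Collect_conj open_Collect_less continuous_intros)
  then show ?thesis by (simp add: triangle_def)
qed

lemma perm_bary_pos: "p \<in> triangle \<Longrightarrow> (perm_mat \<tau> *v bary p) $ i > 0"
  using exhaust_3[of i] by (cases \<tau>) (auto simp: triangle_def perm_mat_action bary_def)

lemma perm_sum: "(perm_mat \<tau> *v v) $ 1 + (perm_mat \<tau> *v v) $ 2 + (perm_mat \<tau> *v v) $ 3
    = v $ 1 + v $ 2 + v $ 3"
  by (cases \<tau>) (simp_all add: perm_mat_action)

lemma perm_bary_sum:
  "(perm_mat \<tau> *v bary p) $ 1 + (perm_mat \<tau> *v bary p) $ 2 + (perm_mat \<tau> *v bary p) $ 3 = 1"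
  by (simp add: perm_sum) (simp add: bary_def)

lemma abs_det_perm_mat: "\<bar>det (perm_mat \<tau>)\<bar> = 1"
  by (cases \<tau>) (simp_all add: perm_mat.simps det_3)

lemma det_mat_B: "det mat_B = 1"
  by (simp add: mat_B_def det_3)

lemma invertible_mat_B: "invertible mat_B"
  by (simp add: invertible_det_nz det_mat_B)

lemma det_matrix_inv_mat_B: "det (matrix_inv mat_B) = 1"
  using det_mul[of mat_B "matrix_inv mat_B"]
  by (simp add: matrix_inv_right invertible_mat_B det_mat_B)

lemma matrix_inv_mat_B_homog: "matrix_inv mat_B *v homog p = bary p"
proof -
  have "homog p = mat_B *v bary p"
    by (simp add: homog_def mat_B_def bary_def vec_eq_iff forall_3 matrix_vector_mult_def sum_3)
  then show ?thesis
    by (simp add: matrix_vector_mul_assoc matrix_inv_left invertible_mat_B)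
qed

lemma det_mat_pow: "det (mat_pow M k) = det M ^ k"
  by (induction k) (simp_all add: det_mul)

lemma base_branch_eq: "mat_pow mat_A1 k *v (mat_A0 *v w) = base_branch k w"
proof (induction k)
  case 0
  show ?case
    by (simp add: base_branch_def mat_A0_def mat_def vec_eq_iff forall_3 matrix_vector_mult_def sum_3)
next
  case (Suc k)
  then show ?case
    by (simp flip: matrix_vector_mul_assoc)
      (simp add: base_branch_def mat_A1_def vec_eq_iff forall_3 matrix_vector_mult_def sum_3
        algebra_simps)
qed

lemma mat_pow_conjugate:
  fixes A P Q :: "real^'n^'n"
  assumes "Q ** P = mat 1"
  shows "mat_pow (P ** A ** Q) k = P ** mat_pow A k ** Q"
proof (induction k)
  case 0
  show ?case using assms matrix_left_right_inverse[of Q P] by simp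
next
  case (Suc k)
  have "mat_pow (P ** A ** Q) (Suc k) = P ** A ** (Q ** P) ** mat_pow A k ** Q"
    by (simp add: Suc matrix_mul_assoc)
  then show ?case by (simp add: assms matrix_mul_assoc)
qed

text \<open>The condition $\tau_1 = \sigma^{-1}$, written for matrices. It makes $F_1$ a conjugate of $A_1$, and
  then all inverse branches are permuted versions of \<open>base_branch\<close>.\<close>

locale triangle_partition =
  fixes \<sigma> \<tau>0 \<tau>1 :: s3
  assumes perm_inverse: "perm_mat \<tau>1 ** perm_mat \<sigma> = mat 1"
begin

abbreviation w :: "real^2 \<Rightarrow> real^3" where
  "w p \<equiv> perm_mat \<tau>0 *v bary p"

text \<open>The denominator $d_k$, by \<open>branch_mat_homog_1\<close> below.\<close>

abbreviation d :: "nat \<Rightarrow> real^2 \<Rightarrow> real" where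
  "d k p \<equiv> 1 + w p $ 3 + k * (w p $ 2 + w p $ 3)"

definition branch_mat :: "nat \<Rightarrow> real^3^3" where
  "branch_mat k = mat_B ** mat_pow (mat_F1 \<sigma> \<tau>1) k ** mat_F0 \<sigma> \<tau>0 ** matrix_inv mat_B"

lemma inv_branch_eq: "inv_branch \<sigma> \<tau>0 \<tau>1 k = proj_map (branch_mat k)"
  by (simp add: fun_eq_iff inv_branch_def branch_vec_def proj_map_def branch_mat_def homog_def Let_def)

lemma abs_det_branch_mat: "\<bar>det (branch_mat k)\<bar> = 1"
proof -
  have "det mat_A0 = 1" "det mat_A1 = 1"
    by (simp_all add: mat_A0_def mat_A1_def det_3)
  then show ?thesis
    by (simp add: branch_mat_def mat_F0_def mat_F1_def det_mul det_mat_pow abs_mult power_abs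
        abs_det_perm_mat det_mat_B det_matrix_inv_mat_B)
qed

lemma invertible_branch_mat: "invertible (branch_mat k)"
  using abs_det_branch_mat[of k] by (auto simp: invertible_det_nz)

text \<open>The factor $\tau_1$ at the right end of $F_1^k$ cancels the factor $\sigma$ at the left end of $F_0$.\<close>

lemma branch_mat_homog:
  "branch_mat k *v homog p = mat_B *v (perm_mat \<sigma> *v base_branch k (w p))"
proof -
  have "mat_pow (mat_F1 \<sigma> \<tau>1) k ** mat_F0 \<sigma> \<tau>0
      = perm_mat \<sigma> ** mat_pow mat_A1 k ** (perm_mat \<tau>1 ** perm_mat \<sigma>) ** mat_A0 ** perm_mat \<tau>0"
    by (simp add: mat_F1_def mat_F0_def mat_pow_conjugate[OF perm_inverse] matrix_mul_assoc)
  also have "\<dots> = perm_mat \<sigma> ** mat_pow mat_A1 k ** mat_A0 ** perm_mat \<tau>0"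
    by (simp add: perm_inverse)
  finally have "branch_mat k
      = mat_B ** (perm_mat \<sigma> ** mat_pow mat_A1 k ** mat_A0 ** perm_mat \<tau>0) ** matrix_inv mat_B"
    by (simp add: branch_mat_def flip: matrix_mul_assoc)
  then show ?thesis
    by (simp add: matrix_inv_mat_B_homog base_branch_eq flip: matrix_vector_mul_assoc)
qed

lemma branch_mat_homog_1: "(branch_mat k *v homog p) $ 1 = d k p"
proof -
  have "(mat_B *v u) $ 1 = u $ 1 + u $ 2 + u $ 3" for u
    by (simp add: mat_B_def matrix_vector_mult_def sum_3)
  then have "(branch_mat k *v homog p) $ 1
      = base_branch k (w p) $ 1 + base_branch k (w p) $ 2 + base_branch k (w p) $ 3"
    by (simp add: branch_mat_homog perm_sum)
  then show ?thesis
    using perm_bary_sum[of \<tau>0 p] by (simp add: base_branch_def)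
qed

lemma d_pos: "p \<in> triangle \<Longrightarrow> d k p > 0"
  by (intro add_pos_nonneg mult_nonneg_nonneg add_nonneg_nonneg)
     (simp_all add: perm_bary_pos less_imp_le)

lemma bary_inv_branch:
  assumes "p \<in> triangle"
  shows "bary (inv_branch \<sigma> \<tau>0 \<tau>1 k p) = (1 / d k p) *s (perm_mat \<sigma> *v base_branch k (w p))"
proof -
  have nz: "(branch_mat k *v homog p) $ 1 \<noteq> 0"
    using d_pos[OF assms, of k] unfolding branch_mat_homog_1 by simp
  show ?thesis
    unfolding inv_branch_eq
    by (subst matrix_inv_mat_B_homog[symmetric], subst homog_proj_map[OF nz],
        unfold branch_mat_homog_1, unfold branch_mat_homog)
       (simp add: vector_scalar_commute matrix_vector_mul_assoc matrix_mul_assoc matrix_inv_left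
          invertible_mat_B)
qed

text \<open>In the coordinates permuted by $\tau_1 = \sigma^{-1}$ the image point no longer depends on \<open>\<sigma>\<close>. This
  is where the eigenfunctions are evaluated on the branches.\<close>

lemma unpermuted_bary_inv_branch:
  assumes "p \<in> triangle"
  shows "perm_mat \<tau>1 *v bary (inv_branch \<sigma> \<tau>0 \<tau>1 k p) = (1 / d k p) *s base_branch k (w p)"
  unfolding bary_inv_branch[OF assms]
  by (simp add: vector_scalar_commute matrix_vector_mul_assoc perm_inverse)

lemma inv_branch_in_triangle:
  assumes "p \<in> triangle"
  shows "inv_branch \<sigma> \<tau>0 \<tau>1 k p \<in> triangle"
proof -
  have pos: "w p $ i > 0" for i
    using assms by (rule perm_bary_pos)
  have "w p $ 3 + real k * (w p $ 2 + w p $ 3) > 0"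
    using pos[of 2] pos[of 3] by (intro add_pos_nonneg mult_nonneg_nonneg) simp_all
  then have "base_branch k (w p) $ i > 0" for i
    using exhaust_3[of i] pos[of 1] pos[of 2] pos[of 3] by (auto simp: base_branch_def)
  then have "(perm_mat \<sigma> *v base_branch k (w p)) $ i > 0" for i
    using exhaust_3[of i] by (cases \<sigma>) (auto simp: perm_mat_action)
  then show ?thesis
    using d_pos[OF assms, of k] by (simp add: triangle_iff_bary_pos bary_inv_branch[OF assms])
qed

section \<open>The fibres and the Jacobian of the triangle partition map\<close>

lemma inj_on_inv_branch: "inj_on (inv_branch \<sigma> \<tau>0 \<tau>1 k) triangle"
proof (rule inj_on_inverseI)
  fix p assume "p \<in> triangle"
  then show "proj_map (matrix_inv (branch_mat k)) (inv_branch \<sigma> \<tau>0 \<tau>1 k p) = p"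
    using d_pos[of p k] unfolding inv_branch_eq
    by (intro proj_map_matrix_inv invertible_branch_mat) (simp add: branch_mat_homog_1)
qed

text \<open>With $v = \tau_1 u$ for the barycentric coordinates $u$ of the image point,
  $v_1/v_3 = k + w_3/(w_2+w_3)$ has integer part $k$, so the image point determines its branch.\<close>

lemma branch_index_unique:
  assumes "p \<in> triangle" "p' \<in> triangle" "inv_branch \<sigma> \<tau>0 \<tau>1 k p = inv_branch \<sigma> \<tau>0 \<tau>1 l p'"
  shows "k = l"
proof -
  define v where "v = perm_mat \<tau>1 *v bary (inv_branch \<sigma> \<tau>0 \<tau>1 k p)"
  have aux: "m = nat \<lfloor>u $ 1 / u $ 3\<rfloor>"
    if "q \<in> triangle" "u = (1 / d m q) *s base_branch m (w q)" for m q u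
  proof -
    have pos: "w q $ 2 > 0" "w q $ 3 > 0" "d m q > 0"
      using that perm_bary_pos d_pos by blast+
    have "u $ 1 / u $ 3 = (w q $ 3 + m * (w q $ 2 + w q $ 3)) / (w q $ 2 + w q $ 3)"
      using pos(3) unfolding that(2) by (simp add: base_branch_def)
    also have "\<dots> = m + w q $ 3 / (w q $ 2 + w q $ 3)"
      using pos by (simp add: field_simps)
    finally have eq: "u $ 1 / u $ 3 = m + w q $ 3 / (w q $ 2 + w q $ 3)" .
    have "\<lfloor>u $ 1 / u $ 3\<rfloor> = int m"
      unfolding eq using pos by (intro floor_unique) simp_all
    then show ?thesis by simp
  qed
  have "v = (1 / d k p) *s base_branch k (w p)"
    unfolding v_def by (rule unpermuted_bary_inv_branch[OF assms(1)])
  moreover have "v = (1 / d l p') *s base_branch l (w p')"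
    unfolding v_def assms(3) by (rule unpermuted_bary_inv_branch[OF assms(2)])
  ultimately show ?thesis
    using aux[OF assms(1)] aux[OF assms(2)] by metis
qed

lemma tp_map_inv_branch:
  assumes "p \<in> triangle"
  shows "tp_map \<sigma> \<tau>0 \<tau>1 (inv_branch \<sigma> \<tau>0 \<tau>1 k p) = p"
proof -
  have "(THE l. inv_branch \<sigma> \<tau>0 \<tau>1 k p \<in> subtriangle \<sigma> \<tau>0 \<tau>1 l) = k"
    using assms branch_index_unique by (intro the_equality) (auto simp: subtriangle_def)
  then show ?thesis
    using assms by (simp add: tp_map_def the_inv_into_f_f inj_on_inv_branch)
qed

lemma tp_fibre_eq:
  assumes "p \<in> triangle"
  shows "tp_fibre \<sigma> \<tau>0 \<tau>1 p = range (\<lambda>k. inv_branch \<sigma> \<tau>0 \<tau>1 k p)"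
  using assms by (auto simp: tp_fibre_def tp_domain_def subtriangle_def tp_map_inv_branch)

text \<open>Openness is needed because the derivative of \<open>tp_map\<close> at a point depends on its values
  in a neighbourhood, and the branch formula for \<open>tp_map\<close> is valid on one subtriangle only.\<close>

lemma open_subtriangle: "open (subtriangle \<sigma> \<tau>0 \<tau>1 k)"
  unfolding subtriangle_def
proof (rule invariance_of_domain)
  show "continuous_on triangle (inv_branch \<sigma> \<tau>0 \<tau>1 k)"
  proof (rule continuous_at_imp_continuous_on, rule ballI)
    fix p assume "p \<in> triangle"
    then have "(branch_mat k *v homog p) $ 1 \<noteq> 0"
      using d_pos[of p k] by (simp add: branch_mat_homog_1)
    then show "isCont (inv_branch \<sigma> \<tau>0 \<tau>1 k) p"
      unfolding inv_branch_eq by (metis proj_map_has_derivative has_derivative_continuous)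
  qed
qed (rule open_triangle inj_on_inv_branch)+

text \<open>On the subtriangle, \<open>tp_map\<close> is the projective map of the inverse matrix, whose determinant is
  $\pm1$ and whose denominator at the image point is $1/d_k$.\<close>

lemma abs_det_jacobian_tp_map:
  assumes "p \<in> triangle"
  shows "\<bar>det (jacobian (tp_map \<sigma> \<tau>0 \<tau>1) (at (inv_branch \<sigma> \<tau>0 \<tau>1 k p)))\<bar> = d k p ^ 3"
proof -
  let ?N = "matrix_inv (branch_mat k)" and ?q = "inv_branch \<sigma> \<tau>0 \<tau>1 k p"
  have nz: "(branch_mat k *v homog p') $ 1 \<noteq> 0" if "p' \<in> triangle" for p'
    using d_pos[OF that, of k] by (simp add: branch_mat_homog_1)
  have N1: "(?N *v homog ?q) $ 1 = 1 / d k p"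
    unfolding inv_branch_eq mult_homog_proj_map_inverse[OF invertible_branch_mat nz[OF assms]]
    unfolding branch_mat_homog_1 by (simp add: homog_def)
  have "(?N *v homog ?q) $ 1 \<noteq> 0"
    using d_pos[OF assms, of k] unfolding N1 by simp
  then obtain D where D: "(proj_map ?N has_derivative D) (at ?q)"
    "det (matrix D) = det ?N / ((?N *v homog ?q) $ 1) ^ 3"
    by (rule proj_map_has_derivative)
  have "(tp_map \<sigma> \<tau>0 \<tau>1 has_derivative D) (at ?q)"
  proof (rule has_derivative_transform_within_open[OF D(1) open_subtriangle])
    show "?q \<in> subtriangle \<sigma> \<tau>0 \<tau>1 k"
      using assms by (simp add: subtriangle_def)
    show "proj_map ?N q = tp_map \<sigma> \<tau>0 \<tau>1 q" if "q \<in> subtriangle \<sigma> \<tau>0 \<tau>1 k" for q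
    proof -
      from that obtain p' where p': "p' \<in> triangle" "q = inv_branch \<sigma> \<tau>0 \<tau>1 k p'"
        by (auto simp: subtriangle_def)
      have "proj_map ?N q = p'"
        unfolding p'(2) inv_branch_eq
        by (rule proj_map_matrix_inv[OF invertible_branch_mat nz[OF p'(1)]])
      then show ?thesis using p' by (simp add: tp_map_inv_branch)
    qed
  qed
  then have "jacobian (tp_map \<sigma> \<tau>0 \<tau>1) (at ?q) = matrix D"
    by (simp add: jacobian_def frechet_derivative_at[symmetric])
  moreover have "\<bar>det ?N\<bar> = 1"
  proof -
    have "det (branch_mat k) * det ?N = 1"
      by (simp add: matrix_inv_right invertible_branch_mat flip: det_mul)
    then have "\<bar>det (branch_mat k)\<bar> * \<bar>det ?N\<bar> = 1"
      by (simp flip: abs_mult)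
    then show ?thesis by (simp add: abs_det_branch_mat)
  qed
  ultimately show ?thesis
    using d_pos[OF assms, of k] by (simp add: D(2) N1 abs_mult power_divide)
qed

text \<open>The fibre of \<open>p\<close> consists of one point for each branch, which gives the transfer operator as the
  series $\sum_k f(S_k(p))/d_k^3$.\<close>

lemma transfer_op_via_branches:
  assumes "p \<in> triangle"
    and "((\<lambda>k. f (inv_branch \<sigma> \<tau>0 \<tau>1 k p) / d k p ^ 3) has_sum s) UNIV"
  shows "(transfer_term \<sigma> \<tau>0 \<tau>1 f has_sum s) (tp_fibre \<sigma> \<tau>0 \<tau>1 p)"
proof -
  have "inj (\<lambda>k. inv_branch \<sigma> \<tau>0 \<tau>1 k p)"
    using branch_index_unique[OF assms(1) assms(1)] by (rule injI)
  moreover have "transfer_term \<sigma> \<tau>0 \<tau>1 f (inv_branch \<sigma> \<tau>0 \<tau>1 k p)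
      = f (inv_branch \<sigma> \<tau>0 \<tau>1 k p) / d k p ^ 3" for k
    by (simp add: transfer_term_def abs_det_jacobian_tp_map[OF assms(1)])
  ultimately show ?thesis
    using assms by (simp add: tp_fibre_eq has_sum_reindex o_def)
qed

end

section \<open>Telescoping\<close>

lemma telescoping_has_sum:
  fixes a b :: real
  assumes "a > 0" "b > 0"
  shows "((\<lambda>k::nat. 1 / ((a + k * b) * (a + Suc k * b))) has_sum 1 / (a * b)) UNIV"
proof (rule sums_nonneg_imp_has_sum)
  have pos: "a + k * b > 0" for k :: nat
    using assms by (intro add_pos_nonneg) auto
  have "filterlim (\<lambda>k. a + real k * b) at_infinity sequentially"
    using assms by (intro tendsto_add_filterlim_at_infinity[OF tendsto_const]
        filterlim_at_top_imp_at_infinity filterlim_at_top_mult_tendsto_pos[OF tendsto_const]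
        filterlim_real_sequentially) auto
  then have "(\<lambda>k. 1 / b * inverse (a + real k * b)) \<longlonglongrightarrow> 1 / b * 0"
    by (intro tendsto_mult tendsto_const filterlim_compose[OF tendsto_inverse_0])
  then have "(\<lambda>k. 1 / b * inverse (a + real k * b) - 1 / b * inverse (a + real (Suc k) * b))
      sums (1 / b * inverse (a + real 0 * b) - 1 / b * 0)"
    by (rule telescope_sums')
  also have "(\<lambda>k. 1 / b * inverse (a + real k * b) - 1 / b * inverse (a + real (Suc k) * b))
      = (\<lambda>k. 1 / ((a + k * b) * (a + Suc k * b)))"
  proof
    fix k
    show "1 / b * inverse (a + real k * b) - 1 / b * inverse (a + real (Suc k) * b)
        = 1 / ((a + k * b) * (a + Suc k * b))"
      using pos[of k] pos[of "Suc k"] assms(2)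
      by (simp add: divide_simps del: of_nat_Suc) (simp add: algebra_simps)
  qed
  finally show "(\<lambda>k. 1 / ((a + real k * b) * (a + real (Suc k) * b))) sums (1 / (a * b))"
    by (simp add: field_simps)
  show "1 / ((a + real k * b) * (a + real (Suc k) * b)) \<ge> 0" for k
    using pos[of k] pos[of "Suc k"] by simp
qed

section \<open>Two patterns of eigenfunctions\<close>

context triangle_partition
begin

lemma eigenfunctionI:
  assumes sum: "\<And>p. p \<in> triangle \<Longrightarrow>
      ((\<lambda>k. h (inv_branch \<sigma> \<tau>0 \<tau>1 k p) / d k p ^ 3) has_sum h p) UNIV"
    and nz: "\<And>p. p \<in> triangle \<Longrightarrow> h p \<noteq> 0"
  shows "is_eigenfunction \<sigma> \<tau>0 \<tau>1 1 h"
  unfolding is_eigenfunction_def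
proof (intro conjI ballI)
  have "(vector [1/2, 1/4] :: real^2) \<in> triangle"
    by (simp add: triangle_def)
  with nz show "\<exists>p\<in>triangle. h p \<noteq> 0" by blast
next
  fix p assume p: "p \<in> triangle"
  note hs = transfer_op_via_branches[OF p sum[OF p]]
  show "transfer_term \<sigma> \<tau>0 \<tau>1 h summable_on tp_fibre \<sigma> \<tau>0 \<tau>1 p"
    using hs by (rule has_sum_imp_summable)
  show "transfer_op \<sigma> \<tau>0 \<tau>1 h p = 1 * h p"
    using infsumI[OF hs] by (simp add: transfer_op_def)
qed

text \<open>Homogenised to degree $-3$, the first expression of $h$ is
  $c/((v_2+v_3)(v_1+v_2+2v_3)(v_1+v_2+v_3))$. The three factors at \<open>base_branch k w\<close> are $1$,
  $d_{k+1}$ and $d_k$, so the branch series telescopes to $c/(d_0(w_2+w_3))$ with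
  $d_0 = 1+w_3$.\<close>

lemma eigenfunction_forward:
  assumes "c \<noteq> 0"
    and branch: "\<And>p v. p \<in> triangle \<Longrightarrow> v = perm_mat \<tau>1 *v bary p \<Longrightarrow>
      h p = c / ((v $ 2 + v $ 3) * (1 + v $ 3))"
    and target: "\<And>p v. p \<in> triangle \<Longrightarrow> v = perm_mat \<tau>0 *v bary p \<Longrightarrow>
      h p = c / ((v $ 2 + v $ 3) * (1 + v $ 3))"
  shows "is_eigenfunction \<sigma> \<tau>0 \<tau>1 1 h"
proof (rule eigenfunctionI)
  fix p assume p: "p \<in> triangle"
  define a b where "a = 1 + w p $ 3" and "b = w p $ 2 + w p $ 3"
  have pos: "w p $ i > 0" for i using p by (rule perm_bary_pos)
  have ab: "a > 0" "b > 0" using pos[of 2] pos[of 3] by (simp_all add: a_def b_def)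
  have hp: "h p = c / (a * b)"
    by (simp add: target[OF p refl] a_def b_def mult.commute)
  show "h p \<noteq> 0" using hp ab \<open>c \<noteq> 0\<close> by simp
  have "h (inv_branch \<sigma> \<tau>0 \<tau>1 k p) / d k p ^ 3 = c * (1 / ((a + k * b) * (a + Suc k * b)))" for k
  proof -
    have d: "d k p = a + k * b" by (simp add: a_def b_def)
    have dpos: "a + k * b > 0" using d_pos[OF p, of k] unfolding d .
    have s: "w p $ 1 + w p $ 2 + w p $ 3 = 1" by (rule perm_bary_sum)
    have "h (inv_branch \<sigma> \<tau>0 \<tau>1 k p)
        = c / ((w p $ 1 / (a + k * b) + b / (a + k * b)) * (1 + b / (a + k * b)))"
      unfolding branch[OF inv_branch_in_triangle[OF p] refl] unpermuted_bary_inv_branch[OF p] d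
      by (simp add: base_branch_def b_def)
    also have "w p $ 1 / (a + k * b) + b / (a + k * b) = 1 / (a + k * b)"
      using s by (simp add: b_def flip: add_divide_distrib)
    also have "1 + b / (a + k * b) = (a + Suc k * b) / (a + k * b)"
      using dpos by (simp add: field_simps)
    finally show ?thesis
      unfolding d using dpos by (simp add: power3_eq_cube)
  qed
  then show "((\<lambda>k. h (inv_branch \<sigma> \<tau>0 \<tau>1 k p) / d k p ^ 3) has_sum h p) UNIV"
    using has_sum_cmult_right[OF telescoping_has_sum[OF ab], of c] by (simp add: hp)
qed

text \<open>Homogenised to degree $-3$, the first expression of $h$ is
  $1/((v_2+v_3)(v_1+v_2)(v_1+v_2+v_3))$. The three factors at \<open>base_branch k w\<close> are $1$,
  $d_k - (w_2+w_3)$ and $d_k$: the progression now begins one step earlier, at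
  $d_0 - (w_2+w_3) = w_1+w_3$. The series telescopes to $1/((w_1+w_3)(w_2+w_3))$, which is not
  the first expression with $w$ in place of $v$; hence the two different hypotheses.\<close>

lemma eigenfunction_backward:
  assumes branch: "\<And>p v. p \<in> triangle \<Longrightarrow> v = perm_mat \<tau>1 *v bary p \<Longrightarrow>
      h p = 1 / ((v $ 2 + v $ 3) * (v $ 1 + v $ 2))"
    and target: "\<And>p v. p \<in> triangle \<Longrightarrow> v = perm_mat \<tau>0 *v bary p \<Longrightarrow>
      h p = 1 / ((v $ 2 + v $ 3) * (v $ 1 + v $ 3))"
  shows "is_eigenfunction \<sigma> \<tau>0 \<tau>1 1 h"
proof (rule eigenfunctionI)
  fix p assume p: "p \<in> triangle"
  define a b where "a = w p $ 1 + w p $ 3" and "b = w p $ 2 + w p $ 3"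
  have pos: "w p $ i > 0" for i using p by (rule perm_bary_pos)
  have ab: "a > 0" "b > 0" using pos[of 1] pos[of 2] pos[of 3] by (simp_all add: a_def b_def)
  have hp: "h p = 1 / (a * b)"
    by (simp add: target[OF p refl] a_def b_def mult.commute)
  show "h p \<noteq> 0" using hp ab by simp
  have "h (inv_branch \<sigma> \<tau>0 \<tau>1 k p) / d k p ^ 3 = 1 / ((a + k * b) * (a + Suc k * b))" for k
  proof -
    have s: "w p $ 1 + w p $ 2 + w p $ 3 = 1" by (rule perm_bary_sum)
    then have d: "d k p = a + Suc k * b" by (simp add: a_def b_def algebra_simps)
    have dpos: "a + Suc k * b > 0" using d_pos[OF p, of k] unfolding d .
    have "h (inv_branch \<sigma> \<tau>0 \<tau>1 k p)
        = 1 / ((w p $ 1 / (a + Suc k * b) + b / (a + Suc k * b))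
             * ((w p $ 3 + k * b) / (a + Suc k * b) + w p $ 1 / (a + Suc k * b)))"
      unfolding branch[OF inv_branch_in_triangle[OF p] refl] unpermuted_bary_inv_branch[OF p] d
      by (simp add: base_branch_def b_def del: of_nat_Suc)
    also have "w p $ 1 / (a + Suc k * b) + b / (a + Suc k * b) = 1 / (a + Suc k * b)"
      using s by (simp add: b_def flip: add_divide_distrib)
    also have "(w p $ 3 + k * b) / (a + Suc k * b) + w p $ 1 / (a + Suc k * b)
        = (a + k * b) / (a + Suc k * b)"
      by (simp add: a_def flip: add_divide_distrib)
    finally show ?thesis
      unfolding d using dpos by (simp add: power3_eq_cube del: of_nat_Suc)
  qed
  then show "((\<lambda>k. h (inv_branch \<sigma> \<tau>0 \<tau>1 k p) / d k p ^ 3) has_sum h p) UNIV"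
    using telescoping_has_sum[OF ab] by (simp add: hp)
qed

end

lemma triangle_partition_inverse_pairs:
  "triangle_partition P_e P_e" "triangle_partition P_12 P_12" "triangle_partition P_13 P_13"
  "triangle_partition P_23 P_23" "triangle_partition P_123 P_132" "triangle_partition P_132 P_123"
  by (unfold_locales; simp add: perm_mat.simps vec_eq_iff forall_3 matrix_matrix_mult_def sum_3 mat_def)+


theorem theorem2:
  shows "is_eigenfunction P_e P_e P_e 1 (\<lambda>p. 1 / (p$1 * (p$2 + 1))) \<and>
         is_eigenfunction P_e P_23 P_e 1 (\<lambda>p. 1 / (p$1 * (1 - p$2))) \<and>
         is_eigenfunction P_e P_132 P_e 1 (\<lambda>p. 1 / (p$1 * (1 - p$2))) \<and>
         is_eigenfunction P_13 P_23 P_13 1 (\<lambda>p. 1 / (p$1 * (1 - p$2))) \<and>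
         is_eigenfunction P_13 P_132 P_13 1 (\<lambda>p. 1 / (p$1 * (1 - p$2))) \<and>
         is_eigenfunction P_12 P_12 P_12 1 (\<lambda>p. 1 / ((p$2 + 1) * (1 - p$1 + p$2))) \<and>
         is_eigenfunction P_12 P_13 P_12 1 (\<lambda>p. 1 / ((1 - p$2) * (1 - p$1 + p$2))) \<and>
         is_eigenfunction P_12 P_123 P_12 1 (\<lambda>p. 1 / ((1 - p$2) * (1 - p$1 + p$2))) \<and>
         is_eigenfunction P_123 P_13 P_132 1 (\<lambda>p. 1 / ((1 - p$2) * (1 - p$1 + p$2))) \<and>
         is_eigenfunction P_123 P_123 P_132 1 (\<lambda>p. 1 / ((1 - p$2) * (1 - p$1 + p$2))) \<and>
         is_eigenfunction P_13 P_13 P_13 1 (\<lambda>p. 1 / ((p$1 - 2) * (1 - p$2))) \<and>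
         is_eigenfunction P_23 P_e P_23 1 (\<lambda>p. 1 / (p$1 * (1 - p$1 + p$2))) \<and>
         is_eigenfunction P_23 P_12 P_23 1 (\<lambda>p. 1 / (p$1 * (1 - p$1 + p$2))) \<and>
         is_eigenfunction P_132 P_e P_123 1 (\<lambda>p. 1 / (p$1 * (1 - p$1 + p$2))) \<and>
         is_eigenfunction P_132 P_12 P_123 1 (\<lambda>p. 1 / (p$1 * (1 - p$1 + p$2))) \<and>
         is_eigenfunction P_23 P_23 P_23 1 (\<lambda>p. 1 / (p$1 * (p$1 - p$2 + 1))) \<and>
         is_eigenfunction P_123 P_132 P_132 1 (\<lambda>p. 1 / ((1 - p$2) * (p$1 - p$2 + 1))) \<and>
         is_eigenfunction P_132 P_123 P_123 1 (\<lambda>p. 1 / ((p$1 - 2) * (1 - p$1 + p$2)))"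
proof (intro conjI)
  show "is_eigenfunction P_e P_e P_e 1 (\<lambda>p. 1 / (p$1 * (p$2 + 1)))"
    by (rule triangle_partition.eigenfunction_forward[OF triangle_partition_inverse_pairs(1), where c = "1"])
      (simp_all add: perm_mat_action bary_def algebra_simps)
  show "is_eigenfunction P_e P_23 P_e 1 (\<lambda>p. 1 / (p$1 * (1 - p$2)))"
    by (rule triangle_partition.eigenfunction_backward[OF triangle_partition_inverse_pairs(1)])
      (simp_all add: perm_mat_action bary_def algebra_simps)
  show "is_eigenfunction P_e P_132 P_e 1 (\<lambda>p. 1 / (p$1 * (1 - p$2)))"
    by (rule triangle_partition.eigenfunction_backward[OF triangle_partition_inverse_pairs(1)])
      (simp_all add: perm_mat_action bary_def algebra_simps)
  show "is_eigenfunction P_13 P_23 P_13 1 (\<lambda>p. 1 / (p$1 * (1 - p$2)))"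
    by (rule triangle_partition.eigenfunction_backward[OF triangle_partition_inverse_pairs(3)])
      (simp_all add: perm_mat_action bary_def algebra_simps)
  show "is_eigenfunction P_13 P_132 P_13 1 (\<lambda>p. 1 / (p$1 * (1 - p$2)))"
    by (rule triangle_partition.eigenfunction_backward[OF triangle_partition_inverse_pairs(3)])
      (simp_all add: perm_mat_action bary_def algebra_simps)
  show "is_eigenfunction P_12 P_12 P_12 1 (\<lambda>p. 1 / ((p$2 + 1) * (1 - p$1 + p$2)))"
    by (rule triangle_partition.eigenfunction_forward[OF triangle_partition_inverse_pairs(2), where c = "1"])
      (simp_all add: perm_mat_action bary_def algebra_simps)
  show "is_eigenfunction P_12 P_13 P_12 1 (\<lambda>p. 1 / ((1 - p$2) * (1 - p$1 + p$2)))"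
    by (rule triangle_partition.eigenfunction_backward[OF triangle_partition_inverse_pairs(2)])
      (simp_all add: perm_mat_action bary_def algebra_simps)
  show "is_eigenfunction P_12 P_123 P_12 1 (\<lambda>p. 1 / ((1 - p$2) * (1 - p$1 + p$2)))"
    by (rule triangle_partition.eigenfunction_backward[OF triangle_partition_inverse_pairs(2)])
      (simp_all add: perm_mat_action bary_def algebra_simps)
  show "is_eigenfunction P_123 P_13 P_132 1 (\<lambda>p. 1 / ((1 - p$2) * (1 - p$1 + p$2)))"
    by (rule triangle_partition.eigenfunction_backward[OF triangle_partition_inverse_pairs(5)])
      (simp_all add: perm_mat_action bary_def algebra_simps)
  show "is_eigenfunction P_123 P_123 P_132 1 (\<lambda>p. 1 / ((1 - p$2) * (1 - p$1 + p$2)))"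
    by (rule triangle_partition.eigenfunction_backward[OF triangle_partition_inverse_pairs(5)])
      (simp_all add: perm_mat_action bary_def algebra_simps)
  show "is_eigenfunction P_13 P_13 P_13 1 (\<lambda>p. 1 / ((p$1 - 2) * (1 - p$2)))"
    by (rule triangle_partition.eigenfunction_forward[OF triangle_partition_inverse_pairs(3), where c = "-1"])
      (simp_all add: perm_mat_action bary_def minus_divide_right algebra_simps)
  show "is_eigenfunction P_23 P_e P_23 1 (\<lambda>p. 1 / (p$1 * (1 - p$1 + p$2)))"
    by (rule triangle_partition.eigenfunction_backward[OF triangle_partition_inverse_pairs(4)])
      (simp_all add: perm_mat_action bary_def algebra_simps)
  show "is_eigenfunction P_23 P_12 P_23 1 (\<lambda>p. 1 / (p$1 * (1 - p$1 + p$2)))"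
    by (rule triangle_partition.eigenfunction_backward[OF triangle_partition_inverse_pairs(4)])
      (simp_all add: perm_mat_action bary_def algebra_simps)
  show "is_eigenfunction P_132 P_e P_123 1 (\<lambda>p. 1 / (p$1 * (1 - p$1 + p$2)))"
    by (rule triangle_partition.eigenfunction_backward[OF triangle_partition_inverse_pairs(6)])
      (simp_all add: perm_mat_action bary_def algebra_simps)
  show "is_eigenfunction P_132 P_12 P_123 1 (\<lambda>p. 1 / (p$1 * (1 - p$1 + p$2)))"
    by (rule triangle_partition.eigenfunction_backward[OF triangle_partition_inverse_pairs(6)])
      (simp_all add: perm_mat_action bary_def algebra_simps)
  show "is_eigenfunction P_23 P_23 P_23 1 (\<lambda>p. 1 / (p$1 * (p$1 - p$2 + 1)))"
    by (rule triangle_partition.eigenfunction_forward[OF triangle_partition_inverse_pairs(4), where c = "1"])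
      (simp_all add: perm_mat_action bary_def algebra_simps)
  show "is_eigenfunction P_123 P_132 P_132 1 (\<lambda>p. 1 / ((1 - p$2) * (p$1 - p$2 + 1)))"
    by (rule triangle_partition.eigenfunction_forward[OF triangle_partition_inverse_pairs(5), where c = "1"])
      (simp_all add: perm_mat_action bary_def algebra_simps)
  show "is_eigenfunction P_132 P_123 P_123 1 (\<lambda>p. 1 / ((p$1 - 2) * (1 - p$1 + p$2)))"
    by (rule triangle_partition.eigenfunction_forward[OF triangle_partition_inverse_pairs(6), where c = "-1"])
      (simp_all add: perm_mat_action bary_def minus_divide_right algebra_simps)
qed

end
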